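(* Let $\mathcal H$ be a Polish space, let $\mathcal A$ be a set of Borel probability measures on $\mathcal H$ that is closed with respect to weak convergence, and let $\mu$ be a Borel probability measure on $\mathcal H$ such that there exists $\nu\in\mathcal A$ with $D_{\rm KL}(\nu\|\mu)<\infty$. Let $\nu_n\in\mathcal A$ satisfy $$D_{\rm KL}(\nu_n\|\mu)\to\inf_{\nu\in\mathcal A}D_{\rm KL}(\nu\|\mu).$$ Then, after passing to a subsequence, $\nu_n$ converges weakly to a $\nu_\star\in\mathcal A$ that realises this infimum, i.e. $D_{\rm KL}(\nu_\star\|\mu)=\inf_{\nu\in\mathcal A}D_{\rm KL}(\nu\|\mu)$. Along the subsequence one has, in addition, $\|\nu_n-\nu_\star\|_{\rm tv}\to0$.
   Context: $D_{\rm KL}(\nu\|\mu)=\int \log\big(\frac{d\nu}{d\mu}\big)\frac{d\nu}{d\mu}\,d\mu$ (with $0\log0=0$) if $\nu\ll\mu$, and $+\infty$ otherwise. The total variation norm is $\|\nu-\mu\|_{\rm tv}=\frac12\int\big|\frac{d\nu}{d\lambda}-\frac{d\mu}{d\lambda}\big|\,d\lambda$ for any probability measure $\lambda$ with $\nu\ll\lambda$ and $\mu\ll\lambda$. *)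

theory Defs
  imports "HOL-Probability.Probability"
begin

text \<open>
  Polish spaces are rendered by the type class \<open>polish_space\<close>. None of the notions below
  refers to the metric of that class, only to its topology.
\<close>

definition borel_prob_measures :: "('a::polish_space) measure set" where
  "borel_prob_measures = {M. prob_space M \<and> sets M = sets borel}"

text \<open>The library's \<open>weak_conv_m\<close> is specific to measures on the real line.\<close>

definition weakly_converges :: "(nat \<Rightarrow> 'a::polish_space measure) \<Rightarrow> 'a measure \<Rightarrow> bool" where
  "weakly_converges \<nu> \<nu>' \<longleftrightarrow>
     (\<forall>f :: 'a \<Rightarrow> real. continuous_on UNIV f \<and> bounded (range f) \<longrightarrow>
        (\<lambda>n. \<integral>x. f x \<partial>\<nu> n) \<longlonglongrightarrow> (\<integral>x. f x \<partial>\<nu>'))"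

text \<open>
  The topology of weak convergence on the probability measures of a Polish space is metrizable,
  so closedness is a matter of sequences.
\<close>

definition weakly_closed :: "('a::polish_space) measure set \<Rightarrow> bool" where
  "weakly_closed \<A> \<longleftrightarrow>
     (\<forall>\<nu> \<nu>'. (\<forall>n. \<nu> n \<in> \<A>) \<and> \<nu>' \<in> borel_prob_measures \<and> weakly_converges \<nu> \<nu>' \<longrightarrow> \<nu>' \<in> \<A>)"

text \<open>
  The library's \<open>KL_divergence\<close> is real valued, and a Bochner integral that does not converge
  is \<open>0\<close>. Here the integral is extended real valued, as the difference of the integrals of the
  positive and the negative part. Note \<open>0 * ln 0 = 0\<close>, that \<open>absolutely_continuous \<mu> \<nu>\<close> and
  \<open>RN_deriv \<mu> \<nu>\<close> mean $\nu \ll \mu$ and $d\nu/d\mu$, and that \<open>RN_deriv \<mu> \<nu>\<close> is finite almost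
  everywhere.
\<close>

definition KL_integrand :: "'a measure \<Rightarrow> 'a measure \<Rightarrow> 'a \<Rightarrow> real" where
  "KL_integrand \<nu> \<mu> x = ln (enn2real (RN_deriv \<mu> \<nu> x)) * enn2real (RN_deriv \<mu> \<nu> x)"

definition KL :: "'a measure \<Rightarrow> 'a measure \<Rightarrow> ereal" where
  "KL \<nu> \<mu> =
     (if absolutely_continuous \<mu> \<nu>
      then enn2ereal (\<integral>\<^sup>+x. ennreal (KL_integrand \<nu> \<mu> x) \<partial>\<mu>)
         - enn2ereal (\<integral>\<^sup>+x. ennreal (- KL_integrand \<nu> \<mu> x) \<partial>\<mu>)
      else \<infinity>)"

text \<open>For a probability measure \<open>\<mu>\<close> the difference above is never \<open>\<infinity> - \<infinity>\<close>.\<close>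

lemma KL_negative_part_le_1:
  assumes "prob_space \<mu>"
  shows "(\<integral>\<^sup>+x. ennreal (- KL_integrand \<nu> \<mu> x) \<partial>\<mu>) \<le> 1"
proof -
  interpret prob_space \<mu> by fact
  have *: "- (ln r * r) \<le> 1" if "0 \<le> r" for r :: real
  proof (cases "r = 0")
    case False
    with that have r: "0 < r" by simp
    have "- ln r \<le> 1 / r - 1"
      using ln_le_minus_one[of "1 / r"] r by (simp add: ln_div)
    then have "- ln r * r \<le> (1 / r - 1) * r"
      using r by (intro mult_right_mono) auto
    also have "\<dots> \<le> 1" using r by (simp add: field_simps)
    finally show ?thesis by simp
  qed simp
  have "(\<integral>\<^sup>+x. ennreal (- KL_integrand \<nu> \<mu> x) \<partial>\<mu>) \<le> (\<integral>\<^sup>+x. 1 \<partial>\<mu>)"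
    by (intro nn_integral_mono) (use * in \<open>auto simp: KL_integrand_def\<close>)
  then show ?thesis by (simp add: emeasure_space_1)
qed

text \<open>
  The measure \<open>\<lambda>\<close> is chosen arbitrarily among the dominating probability measures; one is
  \<open>(\<nu> + \<mu>) / 2\<close>, and by \<open>tv_norm_eq\<close> the value does not depend on the choice.
\<close>

definition dominating :: "'a measure \<Rightarrow> 'a measure \<Rightarrow> 'a measure \<Rightarrow> bool" where
  "dominating \<nu> \<mu> \<Lambda> \<longleftrightarrow> prob_space \<Lambda> \<and> sets \<Lambda> = sets \<nu> \<and> sets \<Lambda> = sets \<mu>
     \<and> absolutely_continuous \<Lambda> \<nu> \<and> absolutely_continuous \<Lambda> \<mu>"

definition tv_norm_wrt :: "'a measure \<Rightarrow> 'a measure \<Rightarrow> 'a measure \<Rightarrow> real" where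
  "tv_norm_wrt \<Lambda> \<nu> \<mu> =
     1/2 * (\<integral>x. \<bar>enn2real (RN_deriv \<Lambda> \<nu> x) - enn2real (RN_deriv \<Lambda> \<mu> x)\<bar> \<partial>\<Lambda>)"

definition tv_norm :: "'a measure \<Rightarrow> 'a measure \<Rightarrow> real" where
  "tv_norm \<nu> \<mu> = tv_norm_wrt (SOME \<Lambda>. dominating \<nu> \<mu> \<Lambda>) \<nu> \<mu>"

lemma tv_norm_wrt_max:
  assumes "prob_space \<nu>" "prob_space \<mu>" "dominating \<nu> \<mu> \<Lambda>"
  shows "\<exists>B\<in>sets \<nu>. tv_norm_wrt \<Lambda> \<nu> \<mu> = measure \<nu> B - measure \<mu> B"
    and "C \<in> sets \<nu> \<Longrightarrow> measure \<nu> C - measure \<mu> C \<le> tv_norm_wrt \<Lambda> \<nu> \<mu>"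
proof -
  interpret \<nu>: prob_space \<nu> by fact
  interpret \<mu>: prob_space \<mu> by fact
  interpret \<Lambda>: prob_space \<Lambda> using assms(3) by (simp add: dominating_def)
  have s: "sets \<nu> = sets \<Lambda>" "sets \<mu> = sets \<Lambda>"
    and ac: "absolutely_continuous \<Lambda> \<nu>" "absolutely_continuous \<Lambda> \<mu>"
    using assms(3) by (auto simp: dominating_def)
  define f where "f x = enn2real (RN_deriv \<Lambda> \<nu> x)" for x
  define g where "g x = enn2real (RN_deriv \<Lambda> \<mu> x)" for x
  have fm [measurable]: "f \<in> borel_measurable \<Lambda>" and gm [measurable]: "g \<in> borel_measurable \<Lambda>"
    unfolding f_def g_def by measurable
  have f: "integrable \<Lambda> f"
    using \<Lambda>.RN_deriv_integrable[OF \<nu>.sigma_finite_measure_axioms ac(1) s(1), of "\<lambda>_. 1"]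
    by (simp add: f_def [abs_def])
  have g: "integrable \<Lambda> g"
    using \<Lambda>.RN_deriv_integrable[OF \<mu>.sigma_finite_measure_axioms ac(2) s(2), of "\<lambda>_. 1"]
    by (simp add: g_def [abs_def])
  have mf: "measure \<nu> C = (\<integral>x. f x * indicator C x \<partial>\<Lambda>)" if "C \<in> sets \<Lambda>" for C
    using \<Lambda>.RN_deriv_integral[OF \<nu>.sigma_finite_measure_axioms ac(1) s(1), of "indicator C"]
      that s sets.sets_into_space[of C \<nu>] by (simp add: f_def Int_absorb2)
  have mg: "measure \<mu> C = (\<integral>x. g x * indicator C x \<partial>\<Lambda>)" if "C \<in> sets \<Lambda>" for C
    using \<Lambda>.RN_deriv_integral[OF \<mu>.sigma_finite_measure_axioms ac(2) s(2), of "indicator C"]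
      that s sets.sets_into_space[of C \<mu>] by (simp add: g_def Int_absorb2)
  have i: "integrable \<Lambda> (\<lambda>x. h x * indicator C x)"
    if "C \<in> sets \<Lambda>" "integrable \<Lambda> h" for C and h :: "_ \<Rightarrow> real"
    using that by (rule integrable_real_mult_indicator)
  have d: "measure \<nu> C - measure \<mu> C = (\<integral>x. (f x - g x) * indicator C x \<partial>\<Lambda>)"
    if "C \<in> sets \<Lambda>" for C
    using i[OF that f] i[OF that g] by (simp add: mf mg that left_diff_distrib)
  have tot: "(\<integral>x. f x - g x \<partial>\<Lambda>) = 0"
    using d[of "space \<Lambda>"] \<nu>.prob_space \<mu>.prob_space s[THEN sets_eq_imp_space_eq]
    by (simp cong: Bochner_Integration.integral_cong)
  have fg: "integrable \<Lambda> (\<lambda>x. f x - g x)" and afg: "integrable \<Lambda> (\<lambda>x. \<bar>f x - g x\<bar>)"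
    using f g by auto
  have tv: "tv_norm_wrt \<Lambda> \<nu> \<mu> = (\<integral>x. 1/2 * (\<bar>f x - g x\<bar> + (f x - g x)) \<partial>\<Lambda>)"
    using fg afg tot by (simp add: tv_norm_wrt_def f_def g_def)
  define B where "B = {x \<in> space \<Lambda>. g x < f x}"
  have B: "B \<in> sets \<Lambda>" unfolding B_def by measurable
  have "tv_norm_wrt \<Lambda> \<nu> \<mu> = (\<integral>x. (f x - g x) * indicator B x \<partial>\<Lambda>)"
    unfolding tv by (intro Bochner_Integration.integral_cong) (auto simp: B_def indicator_def)
  with d[OF B] B s show "\<exists>B\<in>sets \<nu>. tv_norm_wrt \<Lambda> \<nu> \<mu> = measure \<nu> B - measure \<mu> B"
    by (intro bexI[of _ B]) auto
  show "measure \<nu> C - measure \<mu> C \<le> tv_norm_wrt \<Lambda> \<nu> \<mu>" if "C \<in> sets \<nu>"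
  proof -
    have C: "C \<in> sets \<Lambda>" using that s by simp
    show ?thesis
      unfolding d[OF C] tv
      using fg afg i[OF C fg] by (intro integral_mono) (auto simp: indicator_def)
  qed
qed

lemma tv_norm_eq:
  assumes "prob_space \<nu>" "prob_space \<mu>" "dominating \<nu> \<mu> \<Lambda>"
  shows "tv_norm \<nu> \<mu> = tv_norm_wrt \<Lambda> \<nu> \<mu>"
proof -
  have le: "tv_norm_wrt \<Lambda>1 \<nu> \<mu> \<le> tv_norm_wrt \<Lambda>2 \<nu> \<mu>"
    if "dominating \<nu> \<mu> \<Lambda>1" "dominating \<nu> \<mu> \<Lambda>2" for \<Lambda>1 \<Lambda>2
    using tv_norm_wrt_max(1)[OF assms(1,2) that(1)] tv_norm_wrt_max(2)[OF assms(1,2) that(2)]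
    by auto
  have "dominating \<nu> \<mu> (SOME \<Lambda>. dominating \<nu> \<mu> \<Lambda>)"
    using assms(3) by (rule someI)
  with le assms(3) show ?thesis
    unfolding tv_norm_def by (intro antisym) auto
qed

end

theory Submission
  imports Defs "HOL-Complex_Analysis.Great_Picard"
begin

text \<open>
  Write \<open>f\<close> for the density of \<open>\<nu>\<close> with respect to \<open>\<mu>\<close>. For bounded measurable \<open>h\<close>,
  \<open>KL \<nu> \<mu> - \<integral>h d\<nu> - 1 + \<integral>exp h d\<mu>\<close> is the integral of the Bregman divergence
  \<open>f ln f - h f - f + exp h\<close>, which is at least \<open>(sqrt f - exp (h/2))\<^sup>2\<close>. Multiples of
  indicators as \<open>h\<close> show that measures of bounded entropy are uniformly absolutely continuous
  with respect to \<open>\<mu>\<close>. Hence a diagonal subsequence converging on a countable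
  intersection-stable generator converges on every Borel set, and its limit is a probability
  measure; no tightness argument is needed. For \<open>h\<close> the logarithm of the truncated limit density
  the identity passes to the limit, which gives lower semicontinuity of the entropy; once
  the entropies converge to that of the limit, the lower bound on the Bregman divergence
  forces \<open>L\<^sup>1\<close> convergence of the densities.
\<close>

subsection \<open>Setwise convergence of measures\<close>

text \<open>Closing a countable basis under finite intersections keeps it countable and a basis.
  Stability under intersection is what the Dynkin argument below needs, countability what the
  diagonal argument needs.\<close>

lemma countable_Int_stable_generator_borel:
  obtains G :: "'a::second_countable_topology set set"
  where "countable G" "Int_stable G" "sets borel = sigma_sets UNIV G"
proof -
  obtain B :: "'a set set" where B: "countable B" "topological_basis B"
    using ex_countable_basis by blast
  define G where "G = Inter ` {F. finite F \<and> F \<subseteq> B}"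
  have "countable G"
    unfolding G_def by (intro countable_image countable_Collect_finite_subset B)
  moreover have "Int_stable G"
  proof (rule Int_stableI)
    fix a b assume "a \<in> G" "b \<in> G"
    then obtain F F' where "finite F" "F \<subseteq> B" "a = \<Inter>F" "finite F'" "F' \<subseteq> B" "b = \<Inter>F'"
      by (auto simp: G_def)
    then show "a \<inter> b \<in> G"
      by (auto simp: G_def intro!: image_eqI[of _ _ "F \<union> F'"])
  qed
  moreover have "topological_basis G"
  proof -
    have "B \<subseteq> G"
      unfolding G_def by (force intro: image_eqI[of _ _ "{_}"])
    moreover have "open g" if "g \<in> G" for g
      using that topological_basis_open[OF B(2)] by (auto simp: G_def)
    ultimately show ?thesis
      using B(2) unfolding topological_basis_def by (meson order_trans)
  qed
  moreover from calculation have "sets borel = sigma_sets UNIV G"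
    by (subst borel_eq_countable_basis[of G]) (auto simp: sets_measure_of)
  ultimately show thesis using that[of G] by blast
qed

text \<open>The sets on which the masses converge form a Dynkin system: the uniform absolute
  continuity controls the tail of a disjoint union.\<close>

lemma convergent_measure_Dynkin:
  fixes \<nu> :: "nat \<Rightarrow> 'a measure"
  assumes "prob_space \<mu>" and \<nu>: "\<And>n. prob_space (\<nu> n)"
    and s: "sets \<mu> = sigma_sets \<Omega> G" "\<And>n. sets (\<nu> n) = sets \<mu>"
    and G: "Int_stable G" "G \<subseteq> Pow \<Omega>"
    and uac: "\<And>e. e > 0 \<Longrightarrow> \<exists>d>0. \<forall>B\<in>sets \<mu>. measure \<mu> B < d \<longrightarrow> (\<forall>n. measure (\<nu> n) B \<le> e)"
    and conv: "\<And>B. B \<in> G \<Longrightarrow> convergent (\<lambda>n. measure (\<nu> n) B)"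
    and B: "B \<in> sets \<mu>"
  shows "convergent (\<lambda>n. measure (\<nu> n) B)"
proof -
  interpret \<mu>: prob_space \<mu> by fact
  interpret \<nu>: prob_space "\<nu> n" for n by fact
  have "space \<mu> = \<Omega>"
    using sigma_sets_into_sp[OF G(2)] sigma_sets_top[of \<Omega> G] sets.top[of \<mu>] sets.sets_into_space[of \<Omega> \<mu>]
    unfolding s(1) by blast
  then have sp: "space (\<nu> n) = \<Omega>" for n
    using sets_eq_imp_space_eq[OF s(2)[of n]] by simp
  from G B[unfolded s(1)] show ?thesis
  proof (induction rule: sigma_sets_induct_disjoint)
    case (basic A) then show ?case by (rule conv)
  next
    case empty show ?case by (simp add: convergent_const)
  next
    case (compl A)
    then have "A \<in> sets (\<nu> n)" for n using s by simp
    then have "measure (\<nu> n) (\<Omega> - A) = 1 - measure (\<nu> n) A" for n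
      using \<nu>.prob_compl[of A n] sp by simp
    with compl(2) show ?case by (simp add: convergent_diff convergent_const)
  next
    case (union A)
    have A: "A i \<in> sets \<mu>" for i using union(2) s(1) by blast
    have cauchy: "Cauchy (\<lambda>n. measure (\<nu> n) (\<Union>i. A i))"
    proof (rule CauchyI)
      fix e :: real assume "e > 0"
      then obtain d where d: "d > 0"
        "\<And>B n. B \<in> sets \<mu> \<Longrightarrow> measure \<mu> B < d \<Longrightarrow> measure (\<nu> n) B \<le> e/4"
        using uac[of "e/4"] by auto
      \<comment> \<open>The tails decrease to the empty set, so continuity of \<open>\<mu>\<close>
        from above gives one \<open>N\<close> whose tail is small for all \<open>\<nu> n\<close> at
        once.\<close>
      define R where "R N = (\<Union>i. A i) - (\<Union>i<N. A i)" for N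
      have R: "R N \<in> sets \<mu>" for N using A by (auto simp: R_def)
      have "(\<lambda>N. measure \<mu> (R N)) \<longlonglongrightarrow> measure \<mu> (\<Inter>N. R N)"
        using R by (intro \<mu>.finite_Lim_measure_decseq) (force simp: decseq_def R_def)+
      moreover have "(\<Inter>N. R N) = {}" by (auto simp: R_def)
      ultimately have "(\<lambda>N. measure \<mu> (R N)) \<longlonglongrightarrow> 0" by simp
      then have "\<forall>\<^sub>F N in sequentially. measure \<mu> (R N) < d"
        using d(1) by (auto dest: order_tendstoD)
      then obtain N where N: "measure \<mu> (R N) < d"
        by (auto simp: eventually_sequentially)
      have split: "measure (\<nu> n) (\<Union>i. A i) = (\<Sum>i<N. measure (\<nu> n) (A i)) + measure (\<nu> n) (R N)" for n
      proof -
        have "measure (\<nu> n) (\<Union>i. A i) = measure (\<nu> n) (\<Union>i<N. A i) + measure (\<nu> n) (R N)"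
          unfolding R_def using A s(2) 
          by (subst \<nu>.finite_measure_Diff) auto
        also have "measure (\<nu> n) (\<Union>i<N. A i) = (\<Sum>i<N. measure (\<nu> n) (A i))"
          using A s(2) union(1)
          by (intro \<nu>.finite_measure_finite_Union) (auto simp: disjoint_family_on_def)
        finally show ?thesis .
      qed
      have "Cauchy (\<lambda>n. \<Sum>i<N. measure (\<nu> n) (A i))"
        using union(3) by (intro convergent_Cauchy convergent_sum) auto
      from CauchyD[OF this, of "e/2"] \<open>e > 0\<close> obtain M where M:
        "\<And>m n. m \<ge> M \<Longrightarrow> n \<ge> M \<Longrightarrow>
           \<bar>(\<Sum>i<N. measure (\<nu> m) (A i)) - (\<Sum>i<N. measure (\<nu> n) (A i))\<bar> < e/2"
        by auto
      \<comment> \<open>Two tail masses in \<open>[0, e/4]\<close> differ by at most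
        \<open>e/4\<close>, and the finite sums differ by less than \<open>e/2\<close>.\<close>
      have "\<bar>measure (\<nu> m) (\<Union>i. A i) - measure (\<nu> n) (\<Union>i. A i)\<bar> < e" if "m \<ge> M" "n \<ge> M" for m n
        using M[OF that] d(2)[OF R N, of m] d(2)[OF R N, of n]
          measure_nonneg[of "\<nu> m" "R N"] measure_nonneg[of "\<nu> n" "R N"] \<open>e > 0\<close>
        unfolding split by linarith
      then show "\<exists>M. \<forall>m\<ge>M. \<forall>n\<ge>M. norm (measure (\<nu> m) (\<Union>i. A i) - measure (\<nu> n) (\<Union>i. A i)) < e"
        by auto
    qed
    then show ?case by (rule Cauchy_convergent)
  qed
qed

text \<open>Finite additivity passes to setwise limits by itself. Countable additivity reduces to
  continuity at the empty set, which the limit inherits from \<open>\<mu>\<close> through uniform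
  absolute continuity.\<close>

lemma setwise_limit_measure:
  fixes \<nu> :: "nat \<Rightarrow> 'a measure"
  assumes "prob_space \<mu>" and \<nu>: "\<And>n. prob_space (\<nu> n)"
    and s: "\<And>n. sets (\<nu> n) = sets \<mu>"
    and uac: "\<And>e. e > 0 \<Longrightarrow> \<exists>d>0. \<forall>B\<in>sets \<mu>. measure \<mu> B < d \<longrightarrow> (\<forall>n. measure (\<nu> n) B \<le> e)"
    and conv: "\<And>B. B \<in> sets \<mu> \<Longrightarrow> convergent (\<lambda>n. measure (\<nu> n) B)"
  obtains \<nu>' where "prob_space \<nu>'" "sets \<nu>' = sets \<mu>" "absolutely_continuous \<mu> \<nu>'"
    "\<And>B. B \<in> sets \<mu> \<Longrightarrow> (\<lambda>n. measure (\<nu> n) B) \<longlonglongrightarrow> measure \<nu>' B"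
proof -
  interpret \<mu>: prob_space \<mu> by fact
  interpret \<nu>: prob_space "\<nu> n" for n by fact
  define L where "L B = lim (\<lambda>n. measure (\<nu> n) B)" for B
  have L: "(\<lambda>n. measure (\<nu> n) B) \<longlonglongrightarrow> L B" if "B \<in> sets \<mu>" for B
    using conv[OF that] unfolding L_def by (simp add: convergent_LIMSEQ_iff)
  have L0: "0 \<le> L B" if "B \<in> sets \<mu>" for B
    using L[OF that] by (rule LIMSEQ_le_const) simp
  \<comment> \<open>The bound by \<open>e\<close> is uniform in \<open>n\<close> and not strict, so
    it survives the limit with the same \<open>d\<close>.\<close>
  have Ld: "\<exists>d>0. \<forall>B\<in>sets \<mu>. measure \<mu> B < d \<longrightarrow> L B \<le> e" if e: "e > 0" for e
  proof -
    obtain d where d: "d > 0" "\<forall>B\<in>sets \<mu>. measure \<mu> B < d \<longrightarrow> (\<forall>n. measure (\<nu> n) B \<le> e)"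
      using uac[OF e] by blast
    then show ?thesis
      by (intro exI[of _ d] conjI ballI impI) (auto intro: LIMSEQ_le_const2[OF L])
  qed
  have sp: "space (\<nu> n) = space \<mu>" for n using s by (rule sets_eq_imp_space_eq)
  define \<nu>' where "\<nu>' = measure_of (space \<mu>) (sets \<mu>) (\<lambda>B. ennreal (L B))"
  have s': "sets \<nu>' = sets \<mu>" and sp': "space \<nu>' = space \<mu>" by (simp_all add: \<nu>'_def)
  have pos: "positive (sets \<mu>) (\<lambda>B. ennreal (L B))"
    by (simp add: positive_def L_def)
  have add: "additive (sets \<mu>) (\<lambda>B. ennreal (L B))"
    unfolding additive_def
  proof (intro ballI impI)
    fix A B assume AB: "A \<in> sets \<mu>" "B \<in> sets \<mu>" "A \<inter> B = {}"
    have "(\<lambda>n. measure (\<nu> n) A + measure (\<nu> n) B) \<longlonglongrightarrow> L A + L B"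
      by (intro tendsto_add L AB)
    moreover have "measure (\<nu> n) A + measure (\<nu> n) B = measure (\<nu> n) (A \<union> B)" for n
      using AB s by (simp add: \<nu>.finite_measure_Union)
    ultimately have "(\<lambda>n. measure (\<nu> n) (A \<union> B)) \<longlonglongrightarrow> L A + L B"
      by simp
    from LIMSEQ_unique[OF L this] AB have "L (A \<union> B) = L A + L B"
      by simp
    then show "ennreal (L (A \<union> B)) = ennreal (L A) + ennreal (L B)"
      using L0 AB by (simp add: ennreal_plus)
  qed
  have "countably_additive (sets \<mu>) (\<lambda>B. ennreal (L B))"
  proof (rule sets.empty_continuous_imp_countably_additive[OF pos add])
    fix A :: "nat \<Rightarrow> 'a set"
    assume A: "range A \<subseteq> sets \<mu>" "decseq A" "(\<Inter>i. A i) = {}"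
    have 0: "(\<lambda>i. measure \<mu> (A i)) \<longlonglongrightarrow> 0"
      using \<mu>.finite_Lim_measure_decseq[OF A(1,2)] A(3) by simp
    have "(\<lambda>i. L (A i)) \<longlonglongrightarrow> 0"
    proof (rule LIMSEQ_I)
      fix e :: real assume "e > 0"
      then obtain d where d: "d > 0" "\<And>B. B \<in> sets \<mu> \<Longrightarrow> measure \<mu> B < d \<Longrightarrow> L B \<le> e/2"
        using Ld[of "e/2"] by auto
      have "\<forall>\<^sub>F i in sequentially. measure \<mu> (A i) < d"
        using order_tendstoD(2)[OF 0 d(1)] .
      then show "\<exists>N. \<forall>i\<ge>N. norm (L (A i) - 0) < e"
        unfolding eventually_sequentially
      proof (elim exE, intro exI allI impI)
        fix N i assume "\<forall>i\<ge>N. measure \<mu> (A i) < d" "N \<le> i"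
        then have "L (A i) \<le> e/2" "0 \<le> L (A i)" using A(1) d(2)[of "A i"] L0[of "A i"] by auto
        then show "norm (L (A i) - 0) < e" using \<open>e > 0\<close> by simp
      qed
    qed
    then show "(\<lambda>i. ennreal (L (A i))) \<longlonglongrightarrow> 0"
      using tendsto_ennrealI by fastforce
  qed simp
  then have em: "emeasure \<nu>' B = ennreal (L B)" if "B \<in> sets \<mu>" for B
    using that emeasure_measure_of[of \<nu>' "space \<mu>" "sets \<mu>" "\<lambda>B. ennreal (L B)" B] pos
      sets.space_closed[of \<mu>] s' by (simp add: \<nu>'_def)
  have ms: "measure \<nu>' B = L B" if "B \<in> sets \<mu>" for B
    using em[OF that] L0[OF that] by (simp add: measure_def)
  have "L (space \<mu>) = 1"
    using L[of "space \<mu>"] \<nu>.prob_space by (simp add: sp LIMSEQ_const_iff)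
  then have "prob_space \<nu>'"
    by (intro prob_spaceI) (simp add: em sp')
  moreover have "absolutely_continuous \<mu> \<nu>'"
    unfolding absolutely_continuous_def
  proof
    fix B assume "B \<in> null_sets \<mu>"
    then have B: "B \<in> sets \<mu>" "measure \<mu> B = 0" by (auto simp: null_sets_def measure_def)
    \<comment> \<open>A null set has \<open>\<mu>\<close>-mass below every \<open>d\<close>, so its
      limit mass is below every \<open>e\<close>.\<close>
    have "L B \<le> 0"
    proof (rule field_le_epsilon)
      fix e :: real assume "e > 0"
      then show "L B \<le> 0 + e" using Ld[of e] B by auto
    qed
    then show "B \<in> null_sets \<nu>'"
      using B s' em by (auto simp: null_sets_def ennreal_eq_0_iff)
  qed
  ultimately show thesis using that[of \<nu>'] s' ms L by simp
qed

lemma setwise_convergent_subsequence: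
  fixes \<nu> :: "nat \<Rightarrow> 'a::second_countable_topology measure"
  assumes "prob_space \<mu>" and \<nu>: "\<And>n. prob_space (\<nu> n)"
    and s: "sets \<mu> = sets borel" "\<And>n. sets (\<nu> n) = sets \<mu>"
    and uac: "\<And>e. e > 0 \<Longrightarrow> \<exists>d>0. \<forall>B\<in>sets \<mu>. measure \<mu> B < d \<longrightarrow> (\<forall>n. measure (\<nu> n) B \<le> e)"
  obtains r :: "nat \<Rightarrow> nat" and \<nu>'
  where "strict_mono r" "prob_space \<nu>'" "sets \<nu>' = sets \<mu>" "absolutely_continuous \<mu> \<nu>'"
    "\<And>B. B \<in> sets \<mu> \<Longrightarrow> (\<lambda>n. measure (\<nu> (r n)) B) \<longlonglongrightarrow> measure \<nu>' B"
proof -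
  obtain G :: "'a set set"
    where G: "countable G" "Int_stable G" "sets borel = sigma_sets UNIV G"
    using countable_Int_stable_generator_borel by blast
  have "norm (measure (\<nu> n) B) \<le> 1" for n B
    using \<nu> by (simp add: prob_space.prob_le_1)
  \<comment> \<open>This is the diagonal argument: countably many sequences of masses, all bounded
    by 1, converge along a common subsequence.\<close>
  then obtain r :: "nat \<Rightarrow> nat" where r: "strict_mono r"
    "\<And>B. B \<in> G \<Longrightarrow> \<exists>l. (\<lambda>n. measure (\<nu> (r n)) B) \<longlonglongrightarrow> l"
    using function_convergent_subsequence[OF G(1), of "\<lambda>n B. measure (\<nu> n) B" 1] by blast
  have uac': "\<exists>d>0. \<forall>B\<in>sets \<mu>. measure \<mu> B < d \<longrightarrow> (\<forall>n. measure (\<nu> (r n)) B \<le> e)" if "e > 0" for e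
    using uac[OF that] by blast
  have conv: "convergent (\<lambda>n. measure (\<nu> (r n)) B)" if "B \<in> sets \<mu>" for B
    using r(2) G s
    by (intro convergent_measure_Dynkin[OF assms(1) _ _ _ _ _ uac' _ that, where \<Omega>=UNIV and G=G])
       (auto simp: convergent_def \<nu>)
  obtain \<nu>' where "prob_space \<nu>'" "sets \<nu>' = sets \<mu>" "absolutely_continuous \<mu> \<nu>'"
    "\<And>B. B \<in> sets \<mu> \<Longrightarrow> (\<lambda>n. measure (\<nu> (r n)) B) \<longlonglongrightarrow> measure \<nu>' B"
    by (rule setwise_limit_measure[of \<mu> "\<lambda>n. \<nu> (r n)", OF assms(1) \<nu> s(2) uac' conv]) auto
  with that[OF r(1)] show thesis by simp
qed

text \<open>A bounded function is uniformly close to a function with finitely many values, whose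
  integral is a finite combination of masses. The three errors of size \<open>e/3\<close> are two
  approximations and one difference of such combinations.\<close>

lemma setwise_imp_bounded_integral_tendsto:
  fixes \<nu> :: "nat \<Rightarrow> 'a measure" and f :: "'a \<Rightarrow> real"
  assumes "prob_space \<nu>'" and \<nu>: "\<And>n. prob_space (\<nu> n)" and s: "\<And>n. sets (\<nu> n) = sets \<nu>'"
    and lim: "\<And>B. B \<in> sets \<nu>' \<Longrightarrow> (\<lambda>n. measure (\<nu> n) B) \<longlonglongrightarrow> measure \<nu>' B"
    and f: "f \<in> borel_measurable \<nu>'" "\<And>x. \<bar>f x\<bar> \<le> C"
  shows "(\<lambda>n. \<integral>x. f x \<partial>\<nu> n) \<longlonglongrightarrow> (\<integral>x. f x \<partial>\<nu>')"
proof (rule LIMSEQ_I)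
  fix e :: real assume e: "e > 0"
  \<comment> \<open>\<open>g\<close> rounds \<open>f\<close> down to the grid of mesh
    \<open>e/3\<close>. The indices of the grid points it takes lie in \<open>{-K..K}\<close>, and
    \<open>E i\<close> is the level set of index \<open>i\<close>.\<close>
  define g where "g x = (e/3) * of_int \<lfloor>f x / (e/3)\<rfloor>" for x
  define K where "K = \<lceil>C / (e/3)\<rceil> + 1"
  define E where "E i = {x \<in> space \<nu>'. \<lfloor>f x / (e/3)\<rfloor> = i}" for i
  have E: "E i \<in> sets \<nu>'" for i
    unfolding E_def using f(1) by measurable
  have gf: "\<bar>g x - f x\<bar> \<le> e/3" for x
  proof -
    have "f x = (e/3) * (f x / (e/3))" using e by simp
    then have "g x - f x = (e/3) * (of_int \<lfloor>f x / (e/3)\<rfloor> - f x / (e/3))"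
      unfolding g_def by (simp only: right_diff_distrib)
    moreover have "\<bar>of_int \<lfloor>f x / (e/3)\<rfloor> - f x / (e/3)\<bar> \<le> 1" by linarith
    ultimately show ?thesis using e by (simp only: abs_mult mult_left_le abs_of_pos)
  qed
  \<comment> \<open>Neither \<open>K\<close> nor the sets \<open>E i\<close> depend on the measure,
    so the estimate applies to every \<open>\<nu> n\<close> and to \<open>\<nu>'\<close> with the
    same error.\<close>
  have main: "\<bar>(\<integral>x. f x \<partial>M) - (\<Sum>i\<in>{-K..K}. (e/3) * of_int i * measure M (E i))\<bar> \<le> e/3"
    if "prob_space M" and sM: "sets M = sets \<nu>'" for M
  proof -
    interpret M: prob_space M by fact
    have spM: "space M = space \<nu>'" using sM by (rule sets_eq_imp_space_eq)
    have fM [measurable]: "f \<in> borel_measurable M" using f(1) sM by (simp cong: measurable_cong_sets)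
    have g_eq: "g x = (\<Sum>i\<in>{-K..K}. (e/3) * of_int i * indicator (E i) x)" if "x \<in> space M" for x
    proof -
      have "f x / (e/3) \<le> C / (e/3)" "- (C / (e/3)) \<le> f x / (e/3)"
        using f(2)[of x] e by (simp_all add: field_simps abs_le_iff)
      then have "\<lfloor>f x / (e/3)\<rfloor> \<in> {-K..K}"
        unfolding K_def atLeastAtMost_iff by linarith
      moreover have "(\<Sum>i\<in>{-K..K}. (e/3) * of_int i * indicator (E i) x) =
          (\<Sum>i\<in>{-K..K}. if i = \<lfloor>f x / (e/3)\<rfloor> then (e/3) * of_int i else 0)"
        using that spM by (intro sum.cong) (auto simp: E_def)
      ultimately show ?thesis by (simp only: g_def sum.delta' sum.delta finite_atLeastAtMost_int if_True)
    qed
    have EM: "E i \<in> sets M" for i using E sM by simp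
    have "(\<integral>x. g x \<partial>M) = (\<integral>x. (\<Sum>i\<in>{-K..K}. (e/3) * of_int i * indicator (E i) x) \<partial>M)"
      using g_eq by (intro Bochner_Integration.integral_cong) auto
    also have "\<dots> = (\<Sum>i\<in>{-K..K}. (e/3) * of_int i * measure M (E i))"
      using EM by (subst Bochner_Integration.integral_sum) (auto simp: less_top[symmetric])
    finally have gi: "(\<integral>x. g x \<partial>M) = (\<Sum>i\<in>{-K..K}. (e/3) * of_int i * measure M (E i))" .
    have g: "integrable M g"
    proof (rule M.integrable_const_bound)
      show "AE x in M. norm (g x) \<le> C + e/3"
      proof (intro always_eventually allI)
        fix x show "norm (g x) \<le> C + e/3"
          using gf[of x] f(2)[of x] unfolding real_norm_def by linarith
      qed
    qed (unfold g_def, measurable)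
    have fi: "integrable M f"
      using f(2) by (intro M.integrable_const_bound[of _ C]) auto
    have "\<bar>\<integral>x. f x - g x \<partial>M\<bar> \<le> (\<integral>x. \<bar>f x - g x\<bar> \<partial>M)"
      by (rule integral_abs_bound)
    also have "\<dots> \<le> (\<integral>x. e/3 \<partial>M)"
      using fi g gf by (intro integral_mono) (auto simp: abs_minus_commute)
    finally show ?thesis using fi g by (simp add: gi M.prob_space)
  qed
  have "(\<lambda>n. \<Sum>i\<in>{-K..K}. (e/3) * of_int i * measure (\<nu> n) (E i)) \<longlonglongrightarrow>
      (\<Sum>i\<in>{-K..K}. (e/3) * of_int i * measure \<nu>' (E i))"
    by (intro tendsto_intros lim E)
  from LIMSEQ_D[OF this, of "e/3"] e obtain N where
    N: "\<And>n. n \<ge> N \<Longrightarrow> \<bar>(\<Sum>i\<in>{-K..K}. (e/3) * of_int i * measure (\<nu> n) (E i)) -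
      (\<Sum>i\<in>{-K..K}. (e/3) * of_int i * measure \<nu>' (E i))\<bar> < e/3" by auto
  show "\<exists>N. \<forall>n\<ge>N. norm ((\<integral>x. f x \<partial>\<nu> n) - (\<integral>x. f x \<partial>\<nu>')) < e"
  proof (intro exI allI impI)
    fix n assume "n \<ge> N"
    from N[OF this] main[OF \<nu> s, of n] main[OF assms(1) refl]
    show "norm ((\<integral>x. f x \<partial>\<nu> n) - (\<integral>x. f x \<partial>\<nu>')) < e"
      unfolding real_norm_def by linarith
  qed
qed

subsection \<open>Entropy and Bregman divergence\<close>

definition rn_density :: "'a measure \<Rightarrow> 'a measure \<Rightarrow> 'a \<Rightarrow> real" where
  "rn_density \<mu> \<nu> x = enn2real (RN_deriv \<mu> \<nu> x)"

text \<open>The Bregman divergence of \<open>t ln t\<close> at the points \<open>a\<close> and \<open>exp h\<close>.\<close>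

definition bregman :: "real \<Rightarrow> real \<Rightarrow> real" where
  "bregman a h = ln a * a - h * a - a + exp h"

text \<open>For \<open>a > 0\<close>, take \<open>ln t \<le> t - 1\<close> at
  \<open>t = exp (h/2) / sqrt a\<close> and multiply by \<open>2 * a\<close>. Integrated, this
  bounds a squared Hellinger distance by a relative entropy.\<close>

lemma bregman_ge_sqrt:
  assumes "0 \<le> a"
  shows "(sqrt a - exp (h/2))\<^sup>2 \<le> bregman a h"
proof (cases "a = 0")
  case True
  then show ?thesis by (simp add: bregman_def exp_double[symmetric])
next
  case False
  with assms have a: "a > 0" by simp
  have "ln (exp (h/2) / sqrt a) \<le> exp (h/2) / sqrt a - 1"
    using a by (intro ln_le_minus_one) simp
  then have "h/2 - ln a / 2 \<le> exp (h/2) / sqrt a - 1"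
    using a by (simp add: ln_div ln_sqrt)
  then have "(h/2 - ln a / 2) * (2*a) \<le> (exp (h/2) / sqrt a - 1) * (2*a)"
    using a by (intro mult_right_mono) auto
  also have "\<dots> = 2 * (exp (h/2) * sqrt a) - 2 * a"
    using a by (simp add: field_simps)
  finally have "(h/2 - ln a / 2) * (2*a) \<le> 2 * (exp (h/2) * sqrt a) - 2 * a" .
  moreover have "exp (h/2) ^ 2 = exp h" by (simp add: exp_double[symmetric])
  moreover have "sqrt a ^ 2 = a" using a by simp
  ultimately show ?thesis
    unfolding bregman_def power2_diff by (simp add: algebra_simps)
qed

lemma bregman_nonneg: "0 \<le> a \<Longrightarrow> 0 \<le> bregman a h"
  by (rule order_trans[OF _ bregman_ge_sqrt]) auto

text \<open>Factor \<open>a - exp h\<close> as \<open>(u - v) * (u + v)\<close> with square roots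
  \<open>u\<close> and \<open>v\<close>, and split the product by Young's inequality with weight
  \<open>\<eta>\<close>. After integration the second term is \<open>\<eta>\<close> times a bounded
  total mass, so a small Bregman integral forces a small \<open>L1\<close> distance.\<close>

lemma abs_diff_le_bregman:
  assumes a: "0 \<le> a" and \<eta>: "0 < \<eta>"
  shows "\<bar>a - exp h\<bar> \<le> bregman a h / (2*\<eta>) + \<eta> * (a + exp h)"
proof -
  define u v where "u = sqrt a" and "v = exp (h/2)"
  have uv: "u\<^sup>2 = a" "v\<^sup>2 = exp h" "0 \<le> u" "0 \<le> v"
    using a by (simp_all add: u_def v_def exp_double[symmetric])
  define p where "p = \<bar>u - v\<bar>"
  have "0 \<le> (p - \<eta> * (u+v))\<^sup>2" by simp
  then have "2 * \<eta> * (p * (u+v)) \<le> p\<^sup>2 + \<eta>\<^sup>2 * (u+v)\<^sup>2"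
    by (simp add: power2_eq_square algebra_simps)
  also have "\<dots> \<le> p\<^sup>2 + \<eta>\<^sup>2 * (2 * (u\<^sup>2 + v\<^sup>2))"
    using zero_le_power2[of "u - v"]
    by (intro add_left_mono mult_left_mono) (auto simp: power2_eq_square algebra_simps)
  finally have "2 * \<eta> * (p * (u+v)) \<le> p\<^sup>2 + 2 * \<eta>\<^sup>2 * (u\<^sup>2 + v\<^sup>2)"
    by (simp add: algebra_simps)
  moreover have "p\<^sup>2 \<le> bregman a h"
    using bregman_ge_sqrt[OF a, of h] by (simp add: p_def u_def v_def)
  moreover have "p * (u+v) = \<bar>a - exp h\<bar>"
  proof -
    have "p * (u+v) = \<bar>(u - v) * (u + v)\<bar>" using uv by (simp add: p_def abs_mult)
    also have "(u - v) * (u + v) = a - exp h" using uv by (simp add: power2_eq_square algebra_simps)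
    finally show ?thesis .
  qed
  ultimately have "2 * \<eta> * \<bar>a - exp h\<bar> \<le> bregman a h + 2 * \<eta>\<^sup>2 * (a + exp h)"
    using uv by simp
  then show ?thesis
    using \<eta> by (simp add: field_simps power2_eq_square)
qed

text \<open>Truncation on both sides makes \<open>ln (clip k a)\<close> bounded, hence a legitimate
  test function. The shift by one avoids division by zero at \<open>k = 0\<close>, where
  \<open>clip\<close> is constantly 1.\<close>

definition clip :: "nat \<Rightarrow> real \<Rightarrow> real" where
  "clip k a = max (1 / (real k + 1)) (min (real k + 1) a)"

lemma clip_bounds: "1 / (real k + 1) \<le> clip k a" "clip k a \<le> real k + 1" "0 < clip k a"
proof -
  show "1 / (real k + 1) \<le> clip k a" by (simp add: clip_def)
  have "1 / (real k + 1) \<le> real k + 1"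
    by (rule order_trans[of _ 1]) auto
  then show "clip k a \<le> real k + 1" by (simp add: clip_def)
  have "0 < 1 / (real k + 1)" by simp
  then show "0 < clip k a" unfolding clip_def by linarith
qed

lemma abs_ln_clip: "\<bar>ln (clip k a)\<bar> \<le> ln (real k + 1)"
proof -
  have "ln (clip k a) \<le> ln (real k + 1)" using clip_bounds[where k=k and a=a] by simp
  moreover have "ln (1 / (real k + 1)) \<le> ln (clip k a)"
    using clip_bounds[where k=k and a=a] by (subst ln_le_cancel_iff) auto
  ultimately show ?thesis by (simp add: ln_div)
qed

lemma abs_clip_le: "0 \<le> a \<Longrightarrow> \<bar>clip k a\<bar> \<le> a + 1"
proof -
  assume "0 \<le> a"
  moreover have "1 / (real k + 1) \<le> 1" by simp
  ultimately show ?thesis using clip_bounds(3)[of k a] unfolding clip_def by linarith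
qed

lemma measurable_clip [measurable]: "clip k \<in> borel_measurable borel"
  unfolding clip_def[abs_def] by measurable

text \<open>With \<open>c = clip k a\<close>, the expression is \<open>(a - c) * ln c\<close> plus
  \<open>bregman c 0\<close>. Truncation raises \<open>a\<close> only to a value at most 1 and
  lowers it only to a value at least 1, so the two factors of the product never have opposite
  signs.\<close>

lemma clip_ln_nonneg: "0 \<le> a * ln (clip k a) - clip k a + 1"
proof -
  have pos: "1 / (real k + 1) \<le> 1" "1 \<le> real k + 1" by auto
  note c0 = clip_bounds(3)[of k a]
  have "0 \<le> (a - clip k a) * ln (clip k a)"
  proof (cases "a < clip k a")
    case True
    then have "clip k a \<le> 1" using pos by (auto simp: clip_def max_def min_def split: if_splits)
    with True c0 show ?thesis by (intro mult_nonpos_nonpos) auto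
  next
    case False
    then have "a = clip k a \<or> 1 \<le> clip k a"
      using pos unfolding clip_def by linarith
    with False show ?thesis by auto
  qed
  moreover have "0 \<le> bregman (clip k a) 0" using c0 by (intro bregman_nonneg) simp
  ultimately show ?thesis by (simp add: bregman_def algebra_simps)
qed

lemma eventually_clip_eq:
  assumes "0 < a"
  shows "\<forall>\<^sub>F k in sequentially. clip k a = a"
proof -
  have "\<forall>\<^sub>F k in sequentially. a < real k + 1" "\<forall>\<^sub>F k in sequentially. 1 / (real k + 1) < a"
    using assms by real_asymp+
  then show ?thesis
    by eventually_elim (simp add: clip_def)
qed

lemma clip_tendsto:
  assumes "0 \<le> a"
  shows "(\<lambda>k. clip k a) \<longlonglongrightarrow> a" "(\<lambda>k. a * ln (clip k a)) \<longlonglongrightarrow> ln a * a"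
proof -
  show "(\<lambda>k. clip k a) \<longlonglongrightarrow> a"
  proof (cases "a = 0")
    case True
    have "(\<lambda>k. 1 / (real k + 1)) \<longlonglongrightarrow> 0" by real_asymp
    moreover have "clip k 0 = 1 / (real k + 1)" for k by (simp add: clip_def)
    ultimately show ?thesis using True by simp
  qed (use assms eventually_clip_eq in \<open>auto intro: tendsto_eventually\<close>)
  show "(\<lambda>k. a * ln (clip k a)) \<longlonglongrightarrow> ln a * a"
  \<comment> \<open>At \<open>a = 0\<close> the convention \<open>ln 0 * 0 = 0\<close> makes both
    sides vanish; for \<open>a > 0\<close> the truncation is eventually inactive.\<close>
  proof (cases "a = 0")
    case False
    then show ?thesis
      using assms eventually_clip_eq[of a]
      by (auto intro!: tendsto_eventually elim: eventually_mono)
  qed simp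
qed

section \<open>Probability measures with a density: entropy identities and truncation\<close>

locale dominated_prob = \<mu>: prob_space \<mu> + \<nu>: prob_space \<nu> for \<mu> \<nu> :: "'a measure" +
  assumes sets_eq: "sets \<nu> = sets \<mu>" and ac: "absolutely_continuous \<mu> \<nu>"
begin

abbreviation f :: "'a \<Rightarrow> real" where "f \<equiv> rn_density \<mu> \<nu>"

lemma measurable_f [measurable]: "f \<in> borel_measurable \<mu>"
  unfolding rn_density_def[abs_def] by measurable

lemma f_nonneg: "0 \<le> f x"
  by (simp add: rn_density_def)

lemma KL_integrand_eq: "KL_integrand \<nu> \<mu> x = ln (f x) * f x"
  by (simp add: KL_integrand_def rn_density_def)

lemma integral_wrt_density:
  assumes "h \<in> borel_measurable \<mu>"
  shows "(\<integral>x. h x \<partial>\<nu>) = (\<integral>x. f x * h x \<partial>\<mu>)"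
  using \<mu>.RN_deriv_integral[OF \<nu>.sigma_finite_measure_axioms ac sets_eq assms]
  by (simp add: rn_density_def)

lemma integrable_f_mult:
  fixes h :: "'a \<Rightarrow> real"
  assumes h: "h \<in> borel_measurable \<mu>" and C: "\<And>x. \<bar>h x\<bar> \<le> C"
  shows "integrable \<mu> (\<lambda>x. f x * h x)"
proof -
  have "h \<in> borel_measurable \<nu>" using h sets_eq by (simp cong: measurable_cong_sets)
  then have "integrable \<nu> h" using C by (intro \<nu>.integrable_const_bound[of _ C]) auto
  then show ?thesis
    using \<mu>.RN_deriv_integrable[OF \<nu>.sigma_finite_measure_axioms ac sets_eq h]
    by (simp add: rn_density_def)
qed

lemma integrable_f: "integrable \<mu> f"
  using integrable_f_mult[of "\<lambda>_. 1" 1] by simp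

lemma integral_f: "(\<integral>x. f x \<partial>\<mu>) = 1"
  using integral_wrt_density[of "\<lambda>_. 1"] by (simp add: \<nu>.prob_space)

text \<open>On the right-hand side \<open>\<nu>\<close> enters only through its entropy and through
  \<open>\<integral>h d\<nu>\<close>; both can be followed along a setwise convergent sequence,
  although the densities themselves are not known to converge. The constant 1 is the total mass of
  \<open>\<nu>\<close>.\<close>

lemma bregman_integral:
  fixes h :: "'a \<Rightarrow> real"
  assumes int: "integrable \<mu> (KL_integrand \<nu> \<mu>)"
    and h: "h \<in> borel_measurable \<mu>" and C: "\<And>x. \<bar>h x\<bar> \<le> C"
  shows "integrable \<mu> (\<lambda>x. bregman (f x) (h x))"
    and "(\<integral>x. bregman (f x) (h x) \<partial>\<mu>) =
      (\<integral>x. KL_integrand \<nu> \<mu> x \<partial>\<mu>) - (\<integral>x. h x \<partial>\<nu>) - 1 + (\<integral>x. exp (h x) \<partial>\<mu>)"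
    and "integrable \<mu> (\<lambda>x. exp (h x))"
proof -
  have eq: "bregman (f x) (h x) = KL_integrand \<nu> \<mu> x - f x * h x - f x + exp (h x)" for x
    by (simp add: bregman_def KL_integrand_eq)
  show e: "integrable \<mu> (\<lambda>x. exp (h x))"
    using C h by (intro \<mu>.integrable_const_bound[of _ "exp C"]) (auto simp: abs_le_iff)
  note i = int integrable_f_mult[OF h C] integrable_f e
  show "integrable \<mu> (\<lambda>x. bregman (f x) (h x))"
    unfolding eq using i by auto
  show "(\<integral>x. bregman (f x) (h x) \<partial>\<mu>) =
      (\<integral>x. KL_integrand \<nu> \<mu> x \<partial>\<mu>) - (\<integral>x. h x \<partial>\<nu>) - 1 + (\<integral>x. exp (h x) \<partial>\<mu>)"
    unfolding eq integral_wrt_density[OF h] using i by (simp add: integral_f)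
qed

lemma KL_eq_integral:
  assumes "integrable \<mu> (KL_integrand \<nu> \<mu>)"
  shows "KL \<nu> \<mu> = ereal (\<integral>x. KL_integrand \<nu> \<mu> x \<partial>\<mu>)"
proof -
  define P N where "P = (\<integral>\<^sup>+x. ennreal (KL_integrand \<nu> \<mu> x) \<partial>\<mu>)"
    and "N = (\<integral>\<^sup>+x. ennreal (- KL_integrand \<nu> \<mu> x) \<partial>\<mu>)"
  have "P \<noteq> \<top>" "N \<noteq> \<top>"
    using assms by (auto simp: real_integrable_def P_def N_def)
  then have "enn2ereal P = ereal (enn2real P)" "enn2ereal N = ereal (enn2real N)"
    by (metis enn2ereal_ennreal enn2real_nonneg ennreal_enn2real_if)+
  then show ?thesis
    using ac real_lebesgue_integral_def[OF assms] by (simp add: KL_def P_def N_def)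
qed

text \<open>The negative part has integral at most 1, so an infinite positive part would make the
  difference in \<open>KL\<close> infinite.\<close>

lemma integrable_if_KL_finite:
  assumes "KL \<nu> \<mu> < \<infinity>"
  shows "integrable \<mu> (KL_integrand \<nu> \<mu>)"
proof -
  define P N where "P = (\<integral>\<^sup>+x. ennreal (KL_integrand \<nu> \<mu> x) \<partial>\<mu>)"
    and "N = (\<integral>\<^sup>+x. ennreal (- KL_integrand \<nu> \<mu> x) \<partial>\<mu>)"
  have N: "N \<noteq> \<top>"
    using KL_negative_part_le_1[OF \<mu>.prob_space_axioms, of \<nu>] by (auto simp: N_def top_unique)
  have "P \<noteq> \<top>"
  proof
    assume "P = \<top>"
    moreover have "enn2ereal N \<noteq> \<infinity>"
      using N by (metis enn2ereal_inject enn2ereal_top infinity_ennreal_def top_ereal_def)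
    ultimately show False
      using assms ac by (simp add: KL_def P_def[symmetric] N_def[symmetric])
  qed
  moreover have "KL_integrand \<nu> \<mu> \<in> borel_measurable \<mu>"
    unfolding KL_integrand_eq[abs_def] by measurable
  ultimately show ?thesis
    using N by (auto simp: real_integrable_def P_def N_def)
qed

text \<open>The integrated Bregman divergence is nonnegative; here \<open>h\<close> is \<open>c\<close> times the indicator of \<open>B\<close>.\<close>

lemma measure_le_of_entropy:
  assumes int: "integrable \<mu> (KL_integrand \<nu> \<mu>)"
    and K: "(\<integral>x. KL_integrand \<nu> \<mu> x \<partial>\<mu>) \<le> K" and c: "0 < c" and B: "B \<in> sets \<mu>"
  shows "measure \<nu> B \<le> (K + (exp c - 1) * measure \<mu> B) / c"
proof -
  define h where "h x = c * indicator B x" for x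
  have hm: "h \<in> borel_measurable \<mu>" unfolding h_def using B by measurable
  have hb: "\<bar>h x\<bar> \<le> c" for x using c by (auto simp: h_def indicator_def)
  have B': "B \<in> sets \<nu>" using B sets_eq by simp
  \<comment> \<open>Since \<open>h\<close> takes only the values 0 and \<open>c\<close>,
    \<open>exp h\<close> is affine in the indicator, and its integral involves only the mass of
    \<open>B\<close>.\<close>
  have "exp (h x) = 1 + (exp c - 1) * indicator B x" for x
    by (simp add: h_def indicator_def)
  then have "(\<integral>x. exp (h x) \<partial>\<mu>) = 1 + (exp c - 1) * measure \<mu> B"
    using B by (simp add: \<mu>.prob_space less_top[symmetric])
  moreover have "(\<integral>x. h x \<partial>\<nu>) = c * measure \<nu> B"
    using B' by (simp add: h_def)
  moreover have "0 \<le> (\<integral>x. bregman (f x) (h x) \<partial>\<mu>)"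
    by (intro Bochner_Integration.integral_nonneg bregman_nonneg f_nonneg)
  ultimately have "c * measure \<nu> B \<le> K + (exp c - 1) * measure \<mu> B"
    using bregman_integral(2)[OF int hm hb] K by simp
  then show ?thesis using c by (simp add: field_simps)
qed

lemma measurable_ln_clip: "(\<lambda>x. ln (clip k (f x))) \<in> borel_measurable \<mu>"
  by measurable

lemma exp_ln_clip: "exp (ln (clip k (f x))) = clip k (f x)"
  using clip_bounds(3) by simp

lemma integrable_clip: "integrable \<mu> (\<lambda>x. clip k (f x))"
  using clip_bounds[of k]
  by (intro \<mu>.integrable_const_bound[of _ "real k + 1"]) (auto simp: abs_of_pos)

lemma clip_integral_tendsto:
  "(\<lambda>k. \<integral>x. clip k (f x) \<partial>\<mu>) \<longlonglongrightarrow> 1"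
  "(\<lambda>k. \<integral>x. \<bar>clip k (f x) - f x\<bar> \<partial>\<mu>) \<longlonglongrightarrow> 0"
proof -
  have "(\<lambda>k. \<integral>x. clip k (f x) \<partial>\<mu>) \<longlonglongrightarrow> (\<integral>x. f x \<partial>\<mu>)"
    using integrable_f clip_tendsto(1)[OF f_nonneg] abs_clip_le[OF f_nonneg]
    by (intro integral_dominated_convergence[where w="\<lambda>x. f x + 1"]) auto
  then show "(\<lambda>k. \<integral>x. clip k (f x) \<partial>\<mu>) \<longlonglongrightarrow> 1" by (simp add: integral_f)
  have "(\<lambda>k. \<integral>x. \<bar>clip k (f x) - f x\<bar> \<partial>\<mu>) \<longlonglongrightarrow> (\<integral>x. 0 \<partial>\<mu>)"
  proof (intro integral_dominated_convergence[where w="\<lambda>x. 2 * f x + 1"])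
    show "AE x in \<mu>. (\<lambda>k. \<bar>clip k (f x) - f x\<bar>) \<longlonglongrightarrow> 0"
      using clip_tendsto(1)[OF f_nonneg] by (intro always_eventually allI tendsto_rabs_zero) (simp add: LIM_zero)
    show "AE x in \<mu>. norm \<bar>clip k (f x) - f x\<bar> \<le> 2 * f x + 1" for k
    proof (intro always_eventually allI)
      fix x
      show "norm \<bar>clip k (f x) - f x\<bar> \<le> 2 * f x + 1"
        using abs_clip_le[OF f_nonneg, of k x] f_nonneg[of x] by simp
    qed
  qed (use integrable_f in auto)
  then show "(\<lambda>k. \<integral>x. \<bar>clip k (f x) - f x\<bar> \<partial>\<mu>) \<longlonglongrightarrow> 0" by simp
qed

text \<open>Dominated convergence: by \<open>clip_ln_nonneg\<close> the divergence is the integrable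
  function \<open>f ln f - f + 1\<close> minus something nonnegative, and it is itself
  nonnegative.\<close>

lemma bregman_clip_tendsto:
  assumes int: "integrable \<mu> (KL_integrand \<nu> \<mu>)"
  shows "(\<lambda>k. \<integral>x. bregman (f x) (ln (clip k (f x))) \<partial>\<mu>) \<longlonglongrightarrow> 0"
proof -
  have eq: "bregman (f x) (ln (clip k (f x))) =
      KL_integrand \<nu> \<mu> x - f x + 1 - (f x * ln (clip k (f x)) - clip k (f x) + 1)" for x k
    by (simp add: bregman_def KL_integrand_eq exp_ln_clip)
  have "(\<lambda>k. \<integral>x. bregman (f x) (ln (clip k (f x))) \<partial>\<mu>) \<longlonglongrightarrow> (\<integral>x. 0 \<partial>\<mu>)"
  proof (intro integral_dominated_convergence[where w="\<lambda>x. KL_integrand \<nu> \<mu> x - f x + 1"])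
    show "AE x in \<mu>. (\<lambda>k. bregman (f x) (ln (clip k (f x)))) \<longlonglongrightarrow> 0"
    proof (intro always_eventually allI)
      fix x
      have "(\<lambda>k. bregman (f x) (ln (clip k (f x)))) \<longlonglongrightarrow>
          KL_integrand \<nu> \<mu> x - f x + 1 - (ln (f x) * f x - f x + 1)"
        unfolding eq by (intro tendsto_intros clip_tendsto f_nonneg)
      then show "(\<lambda>k. bregman (f x) (ln (clip k (f x)))) \<longlonglongrightarrow> 0"
        by (simp add: KL_integrand_eq)
    qed
    show "AE x in \<mu>. norm (bregman (f x) (ln (clip k (f x)))) \<le> KL_integrand \<nu> \<mu> x - f x + 1" for k
    proof (intro always_eventually allI)
      fix x
      show "norm (bregman (f x) (ln (clip k (f x)))) \<le> KL_integrand \<nu> \<mu> x - f x + 1"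
        using bregman_nonneg[OF f_nonneg, of x "ln (clip k (f x))"] clip_ln_nonneg[of "f x" k]
        unfolding eq by simp
    qed
  qed (use integrable_f int in \<open>auto simp: bregman_def\<close>)
  then show ?thesis by simp
qed

text \<open>Fatou's lemma for the truncations of \<open>f ln f - f + 1\<close>.\<close>

lemma entropy_le_of_truncations:
  assumes J: "\<And>k. (\<integral>x. ln (clip k (f x)) \<partial>\<nu>) - (\<integral>x. clip k (f x) \<partial>\<mu>) + 1 \<le> I"
  shows "integrable \<mu> (KL_integrand \<nu> \<mu>)" "(\<integral>x. KL_integrand \<nu> \<mu> x \<partial>\<mu>) \<le> I"
proof -
  define u where "u k x = f x * ln (clip k (f x)) - clip k (f x) + 1" for k x
  define v where "v x = KL_integrand \<nu> \<mu> x - f x + 1" for x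
  have v: "v x = bregman (f x) 0" for x by (simp add: v_def bregman_def KL_integrand_eq)
  have v0: "0 \<le> v x" for x unfolding v by (intro bregman_nonneg f_nonneg)
  have u0: "0 \<le> u k x" for k x unfolding u_def by (rule clip_ln_nonneg)
  have vm: "v \<in> borel_measurable \<mu>"
    unfolding v_def KL_integrand_eq by measurable
  have um: "u k \<in> borel_measurable \<mu>" for k
    unfolding u_def by measurable
  have fi: "integrable \<mu> (\<lambda>x. f x * ln (clip k (f x)))" for k
    using abs_ln_clip by (intro integrable_f_mult measurable_ln_clip)
  have ui: "integrable \<mu> (u k)" for k
    unfolding u_def using fi integrable_clip by auto
  have uI: "(\<integral>x. u k x \<partial>\<mu>) \<le> I" for k
    using J[of k] fi integrable_clip integral_wrt_density[OF measurable_ln_clip]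
    by (simp add: u_def \<mu>.prob_space)
  have "(\<integral>\<^sup>+x. ennreal (v x) \<partial>\<mu>) = (\<integral>\<^sup>+x. liminf (\<lambda>k. ennreal (u k x)) \<partial>\<mu>)"
  proof (intro nn_integral_cong)
    fix x
    have "(\<lambda>k. u k x) \<longlonglongrightarrow> v x"
      unfolding u_def v_def KL_integrand_eq by (intro tendsto_intros clip_tendsto f_nonneg)
    then have "(\<lambda>k. ennreal (u k x)) \<longlonglongrightarrow> ennreal (v x)" by (rule tendsto_ennrealI)
    then show "ennreal (v x) = liminf (\<lambda>k. ennreal (u k x))"
      by (simp add: lim_imp_Liminf)
  qed
  also have "\<dots> \<le> liminf (\<lambda>k. \<integral>\<^sup>+x. ennreal (u k x) \<partial>\<mu>)"
    using um by (intro nn_integral_liminf) auto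
  also have "\<dots> \<le> ennreal I"
  proof -
    have "(\<integral>\<^sup>+x. ennreal (u k x) \<partial>\<mu>) \<le> ennreal I" for k
      using ui u0 uI by (simp add: nn_integral_eq_integral ennreal_leI)
    then have "liminf (\<lambda>k. \<integral>\<^sup>+x. ennreal (u k x) \<partial>\<mu>) \<le> liminf (\<lambda>k::nat. ennreal I)"
      by (intro Liminf_mono) auto
    then show ?thesis by (simp add: Liminf_const)
  qed
  finally have le: "(\<integral>\<^sup>+x. ennreal (v x) \<partial>\<mu>) \<le> ennreal I" .
  then have vi: "integrable \<mu> v"
    using vm v0 by (intro integrableI_nonneg) (auto simp: less_top[symmetric] top_unique)
  \<comment> \<open>\<open>ennreal\<close> sends negative reals to 0, so the sign of
    \<open>I\<close> must be known before the bound can be read back in the reals.\<close>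
  have I0: "0 \<le> I"
    using uI[of 0] Bochner_Integration.integral_nonneg[of \<mu> "u 0", OF u0] by linarith
  have vI: "(\<integral>x. v x \<partial>\<mu>) \<le> I"
    using le I0 by (simp only: nn_integral_eq_integral[OF vi AE_I2[OF v0]] ennreal_le_iff)
  \<comment> \<open>The added \<open>f\<close> and the subtracted 1 both integrate to 1, so the
    entropy equals the integral of \<open>v\<close>.\<close>
  have eq: "KL_integrand \<nu> \<mu> = (\<lambda>x. v x + f x - 1)" by (auto simp: v_def)
  show "integrable \<mu> (KL_integrand \<nu> \<mu>)" unfolding eq using vi integrable_f by auto
  show "(\<integral>x. KL_integrand \<nu> \<mu> x \<partial>\<mu>) \<le> I"
    unfolding eq using vi integrable_f vI by (simp add: integral_f \<mu>.prob_space)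
qed

end

subsection \<open>Entropy along setwise convergent sequences\<close>

text \<open>Apply \<open>bregman_integral\<close> to each \<open>\<nu> n\<close>. The number
  \<open>I\<close> is only the limit of the entropies; whether it is the entropy of
  \<open>\<nu>'\<close> is left open here.\<close>

lemma bregman_integral_tendsto:
  fixes \<nu> :: "nat \<Rightarrow> 'a measure" and h :: "'a \<Rightarrow> real"
  assumes lim: "dominated_prob \<mu> \<nu>'" and seq: "\<And>n. dominated_prob \<mu> (\<nu> n)"
    and int: "\<And>n. integrable \<mu> (KL_integrand (\<nu> n) \<mu>)"
    and setwise: "\<And>B. B \<in> sets \<mu> \<Longrightarrow> (\<lambda>n. measure (\<nu> n) B) \<longlonglongrightarrow> measure \<nu>' B"
    and ent: "(\<lambda>n. \<integral>x. KL_integrand (\<nu> n) \<mu> x \<partial>\<mu>) \<longlonglongrightarrow> I"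
    and h: "h \<in> borel_measurable \<mu>" "\<And>x. \<bar>h x\<bar> \<le> C"
  shows "(\<lambda>n. \<integral>x. bregman (rn_density \<mu> (\<nu> n) x) (h x) \<partial>\<mu>) \<longlonglongrightarrow>
    I - (\<integral>x. h x \<partial>\<nu>') - 1 + (\<integral>x. exp (h x) \<partial>\<mu>)"
proof -
  interpret lim: dominated_prob \<mu> \<nu>' by fact
  interpret seq: dominated_prob \<mu> "\<nu> n" for n by fact
  have hm: "h \<in> borel_measurable \<nu>'"
    using h(1) lim.sets_eq by (simp cong: measurable_cong_sets)
  have "(\<lambda>n. \<integral>x. h x \<partial>\<nu> n) \<longlonglongrightarrow> (\<integral>x. h x \<partial>\<nu>')"
    using setwise lim.sets_eq seq.sets_eq
    by (intro setwise_imp_bounded_integral_tendsto[OF lim.\<nu>.prob_space_axioms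
          seq.\<nu>.prob_space_axioms _ _ hm h(2)]) auto
  with ent show ?thesis
    unfolding seq.bregman_integral(2)[OF int h] by (intro tendsto_intros)
qed

text \<open>Bregman integrals are nonnegative, hence so is their limit. With the logarithm of the
  truncated limit density as test function, this says that \<open>I\<close> bounds each truncated
  entropy of \<open>\<nu>'\<close>; Fatou's lemma then removes the truncation.\<close>

lemma entropy_lower_semicontinuous:
  fixes \<nu> :: "nat \<Rightarrow> 'a measure"
  assumes lim: "dominated_prob \<mu> \<nu>'" and seq: "\<And>n. dominated_prob \<mu> (\<nu> n)"
    and int: "\<And>n. integrable \<mu> (KL_integrand (\<nu> n) \<mu>)"
    and setwise: "\<And>B. B \<in> sets \<mu> \<Longrightarrow> (\<lambda>n. measure (\<nu> n) B) \<longlonglongrightarrow> measure \<nu>' B"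
    and ent: "(\<lambda>n. \<integral>x. KL_integrand (\<nu> n) \<mu> x \<partial>\<mu>) \<longlonglongrightarrow> I"
  shows "integrable \<mu> (KL_integrand \<nu>' \<mu>)" "(\<integral>x. KL_integrand \<nu>' \<mu> x \<partial>\<mu>) \<le> I"
proof -
  interpret lim: dominated_prob \<mu> \<nu>' by fact
  interpret seq: dominated_prob \<mu> "\<nu> n" for n by fact
  have J: "(\<integral>x. ln (clip k (lim.f x)) \<partial>\<nu>') - (\<integral>x. clip k (lim.f x) \<partial>\<mu>) + 1 \<le> I" for k
  proof -
    have "0 \<le> I - (\<integral>x. ln (clip k (lim.f x)) \<partial>\<nu>') - 1 + (\<integral>x. exp (ln (clip k (lim.f x))) \<partial>\<mu>)"
    proof (rule LIMSEQ_le_const)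
      show "(\<lambda>n. \<integral>x. bregman (rn_density \<mu> (\<nu> n) x) (ln (clip k (lim.f x))) \<partial>\<mu>) \<longlonglongrightarrow>
          I - (\<integral>x. ln (clip k (lim.f x)) \<partial>\<nu>') - 1 + (\<integral>x. exp (ln (clip k (lim.f x))) \<partial>\<mu>)"
        by (rule bregman_integral_tendsto[OF assms lim.measurable_ln_clip abs_ln_clip])
    qed (intro exI allI impI Bochner_Integration.integral_nonneg bregman_nonneg seq.f_nonneg)
    then show ?thesis unfolding lim.exp_ln_clip by linarith
  qed
  show "integrable \<mu> (KL_integrand \<nu>' \<mu>)" "(\<integral>x. KL_integrand \<nu>' \<mu> x \<partial>\<mu>) \<le> I"
    by (rule lim.entropy_le_of_truncations[OF J])+
qed

text \<open>Eventually the densities are within \<open>L\<^sup>1\<close> distance of order \<open>\<epsilon> / \<eta> + \<eta>\<close> of the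
  truncated limit density, where \<open>\<epsilon>\<close> is the integrated Bregman divergence of the limit
  density from its truncation.\<close>

lemma densities_tendsto_L1:
  fixes \<nu> :: "nat \<Rightarrow> 'a measure"
  assumes lim: "dominated_prob \<mu> \<nu>'" and seq: "\<And>n. dominated_prob \<mu> (\<nu> n)"
    and int: "\<And>n. integrable \<mu> (KL_integrand (\<nu> n) \<mu>)"
    and int': "integrable \<mu> (KL_integrand \<nu>' \<mu>)"
    and setwise: "\<And>B. B \<in> sets \<mu> \<Longrightarrow> (\<lambda>n. measure (\<nu> n) B) \<longlonglongrightarrow> measure \<nu>' B"
    and ent: "(\<lambda>n. \<integral>x. KL_integrand (\<nu> n) \<mu> x \<partial>\<mu>) \<longlonglongrightarrow> (\<integral>x. KL_integrand \<nu>' \<mu> x \<partial>\<mu>)"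
  shows "(\<lambda>n. \<integral>x. \<bar>rn_density \<mu> (\<nu> n) x - rn_density \<mu> \<nu>' x\<bar> \<partial>\<mu>) \<longlonglongrightarrow> 0"
proof (rule LIMSEQ_I)
  fix e :: real assume e: "e > 0"
  interpret lim: dominated_prob \<mu> \<nu>' by fact
  interpret seq: dominated_prob \<mu> "\<nu> n" for n by fact
  \<comment> \<open>The final bound is \<open>e/4 + 3 * \<eta> + e/4 = 3 * e / 4\<close>. The factor
    3 bounds the mass 1 of the density plus the mass of the truncation, which is below 2; the first
    \<open>e/4\<close> is \<open>\<eta> * e / 2\<close> divided by
    \<open>2 * \<eta>\<close>.\<close>
  define \<eta> where "\<eta> = e / 12"
  have \<eta>: "\<eta> > 0" using e by (simp add: \<eta>_def)
  define b where "b k = (\<integral>x. bregman (lim.f x) (ln (clip k (lim.f x))) \<partial>\<mu>)" for k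
  have "\<forall>\<^sub>F k in sequentially. b k < \<eta> * e / 2"
    using order_tendstoD(2)[OF lim.bregman_clip_tendsto[OF int'], of "\<eta> * e / 2"] e \<eta>
    by (simp add: b_def)
  moreover have "\<forall>\<^sub>F k in sequentially. (\<integral>x. clip k (lim.f x) \<partial>\<mu>) < 2"
    using order_tendstoD(2)[OF lim.clip_integral_tendsto(1), of 2] by simp
  moreover have "\<forall>\<^sub>F k in sequentially. (\<integral>x. \<bar>clip k (lim.f x) - lim.f x\<bar> \<partial>\<mu>) < e / 4"
    using order_tendstoD(2)[OF lim.clip_integral_tendsto(2), of "e/4"] e by simp
  ultimately have "\<forall>\<^sub>F k in sequentially. b k < \<eta> * e / 2 \<and> (\<integral>x. clip k (lim.f x) \<partial>\<mu>) < 2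
      \<and> (\<integral>x. \<bar>clip k (lim.f x) - lim.f x\<bar> \<partial>\<mu>) < e / 4"
    by eventually_elim simp
  then obtain k where k: "b k < \<eta> * e / 2" "(\<integral>x. clip k (lim.f x) \<partial>\<mu>) < 2"
      "(\<integral>x. \<bar>clip k (lim.f x) - lim.f x\<bar> \<partial>\<mu>) < e / 4"
    by (auto simp: eventually_sequentially)
  define g where "g x = clip k (lim.f x)" for x
  define h where "h x = ln (g x)" for x
  have hm: "h \<in> borel_measurable \<mu>" and hb: "\<And>x. \<bar>h x\<bar> \<le> ln (real k + 1)"
    unfolding h_def g_def by (rule lim.measurable_ln_clip abs_ln_clip)+
  have gh: "exp (h x) = g x" for x
    unfolding h_def g_def by (rule lim.exp_ln_clip)
  have gi: "integrable \<mu> g" unfolding g_def by (rule lim.integrable_clip)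
  \<comment> \<open>The same identity for \<open>\<nu>'\<close> itself. As the entropies converge to
    that of \<open>\<nu>'\<close>, the Bregman integrals of the \<open>\<nu> n\<close> converge to
    exactly \<open>b k\<close>, which is small.\<close>
  have bk: "b k = (\<integral>x. KL_integrand \<nu>' \<mu> x \<partial>\<mu>) - (\<integral>x. h x \<partial>\<nu>') - 1 + (\<integral>x. exp (h x) \<partial>\<mu>)"
    using lim.bregman_integral(2)[OF int' hm hb] by (simp add: b_def h_def g_def)
  have "(\<lambda>n. \<integral>x. bregman (rn_density \<mu> (\<nu> n) x) (h x) \<partial>\<mu>) \<longlonglongrightarrow> b k"
    unfolding bk by (rule bregman_integral_tendsto[OF lim seq int setwise ent hm hb])
  from order_tendstoD(2)[OF this k(1)] obtain N where
    N: "\<And>n. n \<ge> N \<Longrightarrow> (\<integral>x. bregman (rn_density \<mu> (\<nu> n) x) (h x) \<partial>\<mu>) < \<eta> * e / 2"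
    by (auto simp: eventually_sequentially)
  show "\<exists>N. \<forall>n\<ge>N. norm ((\<integral>x. \<bar>rn_density \<mu> (\<nu> n) x - rn_density \<mu> \<nu>' x\<bar> \<partial>\<mu>) - 0) < e"
  proof (intro exI allI impI)
    fix n assume n: "N \<le> n"
    let ?f = "rn_density \<mu> (\<nu> n)" and ?B = "\<lambda>x. bregman (rn_density \<mu> (\<nu> n) x) (h x)"
    have Bi: "integrable \<mu> ?B" by (rule seq.bregman_integral(1)[OF int hm hb])
    note i = Bi gi seq.integrable_f[of n] lim.integrable_f
    \<comment> \<open>Triangle inequality through the truncated limit density
      \<open>g = exp h\<close>.\<close>
    have "\<bar>?f x - lim.f x\<bar> \<le> ?B x / (2*\<eta>) + \<eta> * (?f x + g x) + \<bar>g x - lim.f x\<bar>" for x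
      using abs_diff_le_bregman[OF seq.f_nonneg \<eta>, of n x "h x"] unfolding gh by linarith
    then have "(\<integral>x. \<bar>?f x - lim.f x\<bar> \<partial>\<mu>) \<le>
        (\<integral>x. ?B x / (2*\<eta>) + \<eta> * (?f x + g x) + \<bar>g x - lim.f x\<bar> \<partial>\<mu>)"
      using i by (intro integral_mono) auto
    also have "\<dots> = (\<integral>x. ?B x \<partial>\<mu>) / (2*\<eta>) + \<eta> * (1 + (\<integral>x. g x \<partial>\<mu>)) + (\<integral>x. \<bar>g x - lim.f x\<bar> \<partial>\<mu>)"
      using i by (simp add: seq.integral_f)
    also have "\<dots> < e / 4 + \<eta> * 3 + e / 4"
    proof -
      have "(\<integral>x. ?B x \<partial>\<mu>) / (2*\<eta>) < e / 4"
        using N[OF n] \<eta> by (simp add: field_simps)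
      moreover have "\<eta> * (1 + (\<integral>x. g x \<partial>\<mu>)) \<le> \<eta> * 3"
        using k(2) \<eta> by (intro mult_left_mono) (auto simp: g_def)
      ultimately show ?thesis using k(3) by (simp add: g_def)
    qed
    also have "\<dots> < e" using e by (simp add: \<eta>_def)
    finally have "(\<integral>x. \<bar>?f x - lim.f x\<bar> \<partial>\<mu>) < e" .
    moreover have "0 \<le> (\<integral>x. \<bar>?f x - lim.f x\<bar> \<partial>\<mu>)"
      by (intro Bochner_Integration.integral_nonneg) simp
    ultimately show "norm ((\<integral>x. \<bar>?f x - lim.f x\<bar> \<partial>\<mu>) - 0) < e" by simp
  qed
qed

lemma uniformly_absolutely_continuous_of_entropy:
  fixes \<nu> :: "nat \<Rightarrow> 'a measure"
  assumes seq: "\<And>n. dominated_prob \<mu> (\<nu> n)"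
    and int: "\<And>n. integrable \<mu> (KL_integrand (\<nu> n) \<mu>)"
    and K: "\<And>n. (\<integral>x. KL_integrand (\<nu> n) \<mu> x \<partial>\<mu>) \<le> K" "0 < K"
    and e: "0 < e"
  shows "\<exists>d>0. \<forall>B\<in>sets \<mu>. measure \<mu> B < d \<longrightarrow> (\<forall>n. measure (\<nu> n) B \<le> e)"
proof -
  \<comment> \<open>This makes \<open>K / c\<close> equal to \<open>e/2\<close>. Masses below
    \<open>K / exp c\<close> keep the other term of \<open>measure_le_of_entropy\<close> below
    \<open>K / c\<close> as well.\<close>
  define c where "c = 2 * K / e"
  have c: "0 < c" using K e by (simp add: c_def)
  have "measure (\<nu> n) B \<le> e" if B: "B \<in> sets \<mu>" and m: "measure \<mu> B < K / exp c" for B n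
  proof -
    have "(exp c - 1) * measure \<mu> B \<le> exp c * measure \<mu> B"
      by (intro mult_right_mono) auto
    also have "\<dots> \<le> K" using m by (simp add: field_simps)
    finally have "(K + (exp c - 1) * measure \<mu> B) / c \<le> (2 * K) / c"
      using c by (intro divide_right_mono) auto
    also have "\<dots> = e" using K e by (simp add: c_def)
    finally show ?thesis
      using dominated_prob.measure_le_of_entropy[OF seq int K(1) c B] by (rule order_trans[rotated])
  qed
  then show ?thesis using K by (intro exI[of _ "K / exp c"]) auto
qed

lemma dominated_prob_of_KL_finite:
  assumes "KL \<nu> \<mu> < \<infinity>" "prob_space \<mu>" "prob_space \<nu>" "sets \<nu> = sets \<mu>"
  shows "dominated_prob \<mu> \<nu>"
  using assms by (auto simp: dominated_prob_def dominated_prob_axioms_def KL_def split: if_splits)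

text \<open>Gibbs' inequality, from the test function \<open>h = 0\<close>: the entropy is then
  itself a Bregman integral. It keeps the infimum in the theorem away from minus infinity.\<close>

lemma KL_nonneg:
  assumes "prob_space \<mu>" "prob_space \<nu>" "sets \<nu> = sets \<mu>"
  shows "0 \<le> KL \<nu> \<mu>"
proof (cases "KL \<nu> \<mu> < \<infinity>")
  case True
  then interpret dominated_prob \<mu> \<nu> using assms by (rule dominated_prob_of_KL_finite)
  note int = integrable_if_KL_finite[OF True]
  have "0 \<le> (\<integral>x. bregman (f x) 0 \<partial>\<mu>)"
    by (intro Bochner_Integration.integral_nonneg bregman_nonneg f_nonneg)
  then show ?thesis
    using bregman_integral(2)[OF int, of "\<lambda>_. 0" 0] by (simp add: KL_eq_integral[OF int] \<mu>.prob_space)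
qed auto

text \<open>\<open>\<mu>\<close> dominates both measures, so \<open>tv_norm_eq\<close> lets it
  replace the arbitrarily chosen dominating measure.\<close>

lemma tv_norm_eq_L1:
  assumes "dominated_prob \<mu> \<nu>" "dominated_prob \<mu> \<nu>'"
  shows "tv_norm \<nu> \<nu>' = 1/2 * (\<integral>x. \<bar>rn_density \<mu> \<nu> x - rn_density \<mu> \<nu>' x\<bar> \<partial>\<mu>)"
proof -
  interpret \<nu>: dominated_prob \<mu> \<nu> by fact
  interpret \<nu>': dominated_prob \<mu> \<nu>' by fact
  have "dominating \<nu> \<nu>' \<mu>"
    using \<nu>.\<mu>.prob_space_axioms \<nu>.sets_eq \<nu>'.sets_eq \<nu>.ac \<nu>'.ac by (simp add: dominating_def)
  from tv_norm_eq[OF \<nu>.\<nu>.prob_space_axioms \<nu>'.\<nu>.prob_space_axioms this] show ?thesis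
    by (simp add: tv_norm_wrt_def rn_density_def)
qed

section \<open>Extraction of the minimiser from a minimising sequence\<close>

theorem corollary2p5:
  fixes \<A> :: "('a::polish_space) measure set"
    and \<mu> :: "'a measure"
    and \<nu> :: "nat \<Rightarrow> 'a measure"
  assumes "\<A> \<subseteq> borel_prob_measures"
    and "weakly_closed \<A>"
    and "\<mu> \<in> borel_prob_measures"
    and "\<exists>\<rho>\<in>\<A>. KL \<rho> \<mu> < \<infinity>"
    and "\<And>n. \<nu> n \<in> \<A>"
    and "(\<lambda>n. KL (\<nu> n) \<mu>) \<longlonglongrightarrow> (INF \<rho>\<in>\<A>. KL \<rho> \<mu>)"
  shows "\<exists>(r :: nat \<Rightarrow> nat) \<nu>'. strict_mono r \<and> \<nu>' \<in> \<A>
    \<and> weakly_converges (\<lambda>n. \<nu> (r n)) \<nu>'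
    \<and> KL \<nu>' \<mu> = (INF \<rho>\<in>\<A>. KL \<rho> \<mu>)
    \<and> (\<lambda>n. tv_norm (\<nu> (r n)) \<nu>') \<longlonglongrightarrow> 0"
proof -
  have \<mu>: "prob_space \<mu>" "sets \<mu> = sets borel"
    using assms(3) by (auto simp: borel_prob_measures_def)
  have \<A>: "prob_space \<rho>" "sets \<rho> = sets \<mu>" if "\<rho> \<in> \<A>" for \<rho>
    using assms(1) that \<mu> by (auto simp: borel_prob_measures_def)
  define I where "I = (INF \<rho>\<in>\<A>. KL \<rho> \<mu>)"
  obtain \<rho> where \<rho>: "\<rho> \<in> \<A>" "KL \<rho> \<mu> < \<infinity>" using assms(4) by blast
  have "I < \<infinity>" using INF_lower[OF \<rho>(1)] \<rho>(2) unfolding I_def by (rule le_less_trans)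
  moreover have "0 \<le> I"
    unfolding I_def using \<A> by (intro INF_greatest KL_nonneg \<mu>) auto
  ultimately obtain i where i: "I = ereal i" "0 \<le> i" by (cases I) auto
  \<comment> \<open>Early members of the sequence may have infinite entropy, so the first
    \<open>N\<close> are dropped. The bound \<open>i + 1\<close> is positive, as the uniform
    absolute continuity lemma demands.\<close>
  have "\<forall>\<^sub>F n in sequentially. KL (\<nu> n) \<mu> < ereal (i + 1)"
    using assms(6) unfolding I_def[symmetric] i(1) by (rule order_tendstoD) simp
  then obtain N where N: "\<And>n. n \<ge> N \<Longrightarrow> KL (\<nu> n) \<mu> < ereal (i + 1)"
    by (auto simp: eventually_sequentially)
  define \<sigma> where "\<sigma> n = \<nu> (n + N)" for n
  have \<sigma>\<A>: "\<sigma> n \<in> \<A>" for n using assms(5) by (simp add: \<sigma>_def)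
  have fin: "KL (\<sigma> n) \<mu> < \<infinity>" and lt: "KL (\<sigma> n) \<mu> < ereal (i + 1)" for n
    using N[of "n + N"] by (auto simp: \<sigma>_def intro: less_trans)
  have seq: "dominated_prob \<mu> (\<sigma> n)" for n
    using fin \<mu>(1) \<A>[OF \<sigma>\<A>] by (rule dominated_prob_of_KL_finite)
  have int: "integrable \<mu> (KL_integrand (\<sigma> n) \<mu>)" for n
    using seq fin by (rule dominated_prob.integrable_if_KL_finite)
  have KL\<sigma>: "KL (\<sigma> n) \<mu> = ereal (\<integral>x. KL_integrand (\<sigma> n) \<mu> x \<partial>\<mu>)" for n
    using seq int by (rule dominated_prob.KL_eq_integral)
  have bound: "(\<integral>x. KL_integrand (\<sigma> n) \<mu> x \<partial>\<mu>) \<le> i + 1" for n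
    using lt[of n] by (simp add: KL\<sigma>)
  have ent: "(\<lambda>n. \<integral>x. KL_integrand (\<sigma> n) \<mu> x \<partial>\<mu>) \<longlonglongrightarrow> i"
    using LIMSEQ_ignore_initial_segment[OF assms(6), of N]
    by (simp add: I_def[symmetric] i(1) \<sigma>_def[symmetric] KL\<sigma>)
  obtain s :: "nat \<Rightarrow> nat" and \<nu>' where s: "strict_mono s"
    and \<nu>': "prob_space \<nu>'" "sets \<nu>' = sets \<mu>" "absolutely_continuous \<mu> \<nu>'"
    and setwise: "\<And>B. B \<in> sets \<mu> \<Longrightarrow> (\<lambda>n. measure (\<sigma> (s n)) B) \<longlonglongrightarrow> measure \<nu>' B"
  proof (rule setwise_convergent_subsequence[OF \<mu>(1) \<A>(1)[OF \<sigma>\<A>] \<mu>(2) \<A>(2)[OF \<sigma>\<A>]])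
    show "\<exists>d>0. \<forall>B\<in>sets \<mu>. measure \<mu> B < d \<longrightarrow> (\<forall>n. measure (\<sigma> n) B \<le> e)" if "0 < e" for e
      using i(2) that by (intro uniformly_absolutely_continuous_of_entropy[OF seq int bound]) auto
  qed (rule that)
  have lim: "dominated_prob \<mu> \<nu>'"
    using \<mu>(1) \<nu>' by (simp add: dominated_prob_def dominated_prob_axioms_def)
  have ent': "(\<lambda>n. \<integral>x. KL_integrand (\<sigma> (s n)) \<mu> x \<partial>\<mu>) \<longlonglongrightarrow> i"
    using LIMSEQ_subseq_LIMSEQ[OF ent s] by (simp add: o_def)
  note lsc = entropy_lower_semicontinuous[OF lim seq int setwise ent']
  have KL\<nu>': "KL \<nu>' \<mu> = ereal (\<integral>x. KL_integrand \<nu>' \<mu> x \<partial>\<mu>)"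
    using lim lsc(1) by (rule dominated_prob.KL_eq_integral)
  \<comment> \<open>Setwise convergence gives convergence of integrals of all bounded measurable
    functions, in particular of the continuous ones.\<close>
  have weak: "weakly_converges (\<lambda>n. \<sigma> (s n)) \<nu>'"
    unfolding weakly_converges_def
  proof (intro allI impI)
    fix \<phi> :: "'a \<Rightarrow> real" assume \<phi>: "continuous_on UNIV \<phi> \<and> bounded (range \<phi>)"
    then obtain C where C: "\<And>x. \<bar>\<phi> x\<bar> \<le> C" by (auto simp: bounded_iff)
    have "\<phi> \<in> borel_measurable \<nu>'"
      using \<phi> borel_measurable_continuous_onI[of \<phi>] \<nu>'(2) \<mu>(2)
      by (simp cong: measurable_cong_sets)
    then show "(\<lambda>n. \<integral>x. \<phi> x \<partial>\<sigma> (s n)) \<longlonglongrightarrow> (\<integral>x. \<phi> x \<partial>\<nu>')"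
      using setwise \<nu>'(2) \<A>[OF \<sigma>\<A>] C
      by (intro setwise_imp_bounded_integral_tendsto[OF \<nu>'(1)]) auto
  qed
  have \<nu>'\<A>: "\<nu>' \<in> \<A>"
  proof (rule assms(2)[unfolded weakly_closed_def, rule_format])
    show "(\<forall>n. \<sigma> (s n) \<in> \<A>) \<and> \<nu>' \<in> borel_prob_measures \<and> weakly_converges (\<lambda>n. \<sigma> (s n)) \<nu>'"
      using \<sigma>\<A> weak \<nu>'(1,2) \<mu>(2) by (simp add: borel_prob_measures_def)
  qed
  \<comment> \<open>Membership in \<open>\<A>\<close> gives one inequality and lower semicontinuity
    the other. The resulting equality is the convergence of entropies that
    \<open>densities_tendsto_L1\<close> requires.\<close>
  have "I \<le> KL \<nu>' \<mu>" unfolding I_def using \<nu>'\<A> by (rule INF_lower)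
  with lsc(2) have eq: "(\<integral>x. KL_integrand \<nu>' \<mu> x \<partial>\<mu>) = i" by (simp add: KL\<nu>' i(1))
  have "(\<lambda>n. tv_norm (\<sigma> (s n)) \<nu>') \<longlonglongrightarrow> 0"
    unfolding tv_norm_eq_L1[OF seq lim]
    by (intro tendsto_mult_right_zero densities_tendsto_L1[OF lim seq int lsc(1) setwise])
       (simp_all add: eq ent')
  \<comment> \<open>Adding \<open>N\<close> turns indices of \<open>\<sigma>\<close> back into
    indices of \<open>\<nu>\<close>.\<close>
  moreover have "strict_mono (\<lambda>n. s n + N)" using s by (simp add: strict_mono_def)
  ultimately show ?thesis
    using \<nu>'\<A> weak KL\<nu>' eq i(1) unfolding \<sigma>_def I_def
    by (intro exI[of _ "\<lambda>n. s n + N"] exI[of _ \<nu>']) simp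
qed

end
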